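(* Let $K$ be a field, $S=K[t_1,\ldots,t_s]$. Let $g_1,\ldots,g_s\in S$ be the binomials defined by the rows of an $s\times s$ GCB matrix $L$ and let $I$ be the ideal generated by $g_1,\ldots,g_s$. If $V(I,t_i)=\{0\}$ and $|{\rm supp}(g_i)|\geq 3$ for all $i$, then $I$ is not a complete intersection.
   Context: An $s\times s$ integer matrix $L$ is a GCB (generalized critical binomial) matrix if its diagonal entries are $a_{1,1},\ldots,a_{s,s}>0$, its off-diagonal entries are $-a_{i,j}$ with $a_{i,j}\in\mathbb{N}$ ($\mathbb{N}=\{0,1,\ldots\}$), each column has at least one non-zero off-diagonal entry, and there exists a vector $\mathbf{b}$ of $s$ positive integers with $L\mathbf{b}^\top=0$. For $a\in\mathbb{Z}^s$ write $a=a^+-a^-$ with $a^\pm\in\mathbb{N}^s$ of disjoint support; the binomial defined by $a$ is $t^{a^+}-t^{a^-}$, where $t^c=t_1^{c_1}\cdots t_s^{c_s}$. ${\rm supp}(g)$ is the set of variables $t_i$ occurring in $g$. $V(\cdot)$ is the set of common zeros in $K^s$ and $V(I,t_i)=V((I,t_i))$. An ideal $I$ is a complete intersection if it can be generated by ${\rm ht}(I)$ elements. *)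

theory Defs
  imports
    "HOL-Analysis.Finite_Cartesian_Product"
    "HOL-Algebra.Algebraic_Closure_Type"
    "HOL-Algebra.Ideal"
    "HOL-Library.Poly_Mapping"
    "HOL-Library.Extended_Nat"
begin

section \<open>Polynomials in finitely many variables\<close>

text \<open>
  The variables are indexed by a finite type \<open>'s\<close>, so that the number of variables is \<open>CARD('s)\<close>.
  A polynomial maps exponent vectors to coefficients; the arithmetic operations
  on \<open>poly_mapping\<close> are then exactly those of the polynomial ring.
\<close>

type_synonym ('s, 'k) mpoly = "('s \<Rightarrow>\<^sub>0 nat) \<Rightarrow>\<^sub>0 'k"

abbreviation mpoly_ring :: "('s, 'k :: field) mpoly ring" where
  "mpoly_ring \<equiv> ring_of_type_algebra"

lift_definition exponent_vector :: "('s :: finite \<Rightarrow> nat) \<Rightarrow> ('s \<Rightarrow>\<^sub>0 nat)" is "\<lambda>c. c"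
  by simp

definition monomial :: "('s :: finite \<Rightarrow> nat) \<Rightarrow> ('s, 'k :: field) mpoly" where
  "monomial c = Poly_Mapping.single (exponent_vector c) 1"

definition var :: "'s :: finite \<Rightarrow> ('s, 'k :: field) mpoly" where
  "var i = monomial (\<lambda>j. if j = i then 1 else 0)"

definition supp :: "('s, 'k :: field) mpoly \<Rightarrow> 's set" where
  "supp p = (\<Union>m \<in> Poly_Mapping.keys p. Poly_Mapping.keys m)"

definition eval :: "('s :: finite, 'k :: field) mpoly \<Rightarrow> 'k ^ 's \<Rightarrow> 'k" where
  "eval p x = (\<Sum>m \<in> Poly_Mapping.keys p.
     Poly_Mapping.lookup p m * (\<Prod>i \<in> UNIV. (x $ i) ^ Poly_Mapping.lookup m i))"

definition zero_locus :: "('s :: finite, 'k :: field) mpoly set \<Rightarrow> ('k ^ 's) set" where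
  "zero_locus J = {x. \<forall>p \<in> J. eval p x = 0}"

section \<open>Height and complete intersections\<close>

text \<open>The supremum of the lengths \<open>n\<close> of chains \<open>C 0 \<subset> \<dots> \<subset> C n = P\<close> of prime ideals.\<close>

definition prime_height :: "('a, 'm) ring_scheme \<Rightarrow> 'a set \<Rightarrow> enat" where
  "prime_height R P = Sup {enat n | n. \<exists>C :: nat \<Rightarrow> 'a set.
     (\<forall>i \<le> n. primeideal (C i) R) \<and> (\<forall>i < n. C i \<subset> C (Suc i)) \<and> C n = P}"

text \<open>The height of the unit ideal is \<open>\<infinity>\<close>, as an infimum over the empty set.\<close>

definition ideal_height :: "('a, 'm) ring_scheme \<Rightarrow> 'a set \<Rightarrow> enat" where
  "ideal_height R I = Inf {prime_height R P | P. primeideal P R \<and> I \<subseteq> P}"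

definition complete_intersection :: "('a, 'm) ring_scheme \<Rightarrow> 'a set \<Rightarrow> bool" where
  "complete_intersection R I \<longleftrightarrow>
     (\<exists>fs. set fs \<subseteq> carrier R \<and> enat (length fs) = ideal_height R I \<and> I = Idl\<^bsub>R\<^esub> (set fs))"

section \<open>Generalized critical binomial matrices\<close>

definition GCB_matrix :: "int ^ 's ^ ('s :: finite) \<Rightarrow> bool" where
  "GCB_matrix L \<longleftrightarrow>
     (\<forall>i. L $ i $ i > 0) \<and>
     (\<forall>i j. i \<noteq> j \<longrightarrow> L $ i $ j \<le> 0) \<and>
     (\<forall>j. \<exists>i. i \<noteq> j \<and> L $ i $ j \<noteq> 0) \<and>
     (\<exists>b :: int ^ 's. (\<forall>i. b $ i > 0) \<and> L *v b = 0)"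

text \<open>As \<open>nat\<close> truncates negative integers to \<open>0\<close>, the two exponent vectors are the positive
  and the negative part of \<open>a\<close>.\<close>

definition binomial_of :: "int ^ ('s :: finite) \<Rightarrow> ('s, 'k :: field) mpoly" where
  "binomial_of a = monomial (\<lambda>i. nat (a $ i)) - monomial (\<lambda>i. nat (- (a $ i)))"

end

theory Submission
  imports Defs "HOL-Analysis.Cartesian_Space"
begin

text \<open>
  Let \<open>e i\<close> be the exponent vector of the pure power in \<open>g i\<close>. As \<open>g i\<close> involves at least three
  variables, every other monomial of \<open>g 1, \<dots>, g s\<close> fails to divide the monomial with exponent
  \<open>e i\<close>. Hence the coefficients at \<open>e 1, \<dots>, e s\<close> define a map from \<open>I\<close> onto \<open>K\<^sup>s\<close> that is semilinear
  along \<open>r \<mapsto> r(0)\<close>, and every generating set of \<open>I\<close> has at least \<open>s\<close> elements.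
  On the other hand \<open>I\<close> lies in the kernel \<open>P\<close> of \<open>t i \<mapsto> T ^ b i\<close>, a prime strictly contained in
  the ideal of the origin. A chain of primes up to \<open>P\<close> of length \<open>n\<close> thus yields \<open>n + 1\<close>
  algebraically independent polynomials, and counting the monomials in them gives \<open>n + 1 \<le> s\<close>.
\<close>

section \<open>Ideals in a type class ring\<close>

text \<open>Replaces the locale predicate by closure conditions in type class operations. Negatives
  come for free, since \<open>- x = (-1) * x\<close>.\<close>

lemma ideal_ring_of_type_algebra_iff:
  fixes J :: "'a :: comm_ring_1 set"
  shows "ideal J ring_of_type_algebra \<longleftrightarrow>
    0 \<in> J \<and> (\<forall>x\<in>J. \<forall>y\<in>J. x + y \<in> J) \<and> (\<forall>x\<in>J. \<forall>r. r * x \<in> J)"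
proof
  assume "ideal J ring_of_type_algebra"
  then interpret ideal J "ring_of_type_algebra :: 'a ring" .
  show "0 \<in> J \<and> (\<forall>x\<in>J. \<forall>y\<in>J. x + y \<in> J) \<and> (\<forall>x\<in>J. \<forall>r. r * x \<in> J)"
    using additive_subgroup.zero_closed[OF additive_subgroup_axioms]
      additive_subgroup.a_closed[OF additive_subgroup_axioms] I_l_closed
    by (auto simp: ring_of_type_algebra_def)
next
  assume J: "0 \<in> J \<and> (\<forall>x\<in>J. \<forall>y\<in>J. x + y \<in> J) \<and> (\<forall>x\<in>J. \<forall>r. r * x \<in> J)"
  interpret R: ring "ring_of_type_algebra :: 'a ring" by (rule ring_from_type_algebra)
  have inv: "\<ominus>\<^bsub>ring_of_type_algebra\<^esub> x = - x" for x :: 'a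
    by (rule R.minus_equality) (auto simp: ring_of_type_algebra_def)
  show "ideal J ring_of_type_algebra"
  proof (rule idealI)
    show "ring (ring_of_type_algebra :: 'a ring)" by (rule R.ring_axioms)
    show "subgroup J (add_monoid (ring_of_type_algebra :: 'a ring))"
    proof (rule R.add.subgroupI)
      show "\<ominus>\<^bsub>ring_of_type_algebra\<^esub> x \<in> J" if "x \<in> J" for x
        using J that unfolding inv by (metis mult_minus1)
    qed (use J in \<open>auto simp: ring_of_type_algebra_def\<close>)
    show "x \<otimes>\<^bsub>ring_of_type_algebra\<^esub> a \<in> J" if "a \<in> J" for a x
      using J that by (auto simp: ring_of_type_algebra_def)
    show "a \<otimes>\<^bsub>ring_of_type_algebra\<^esub> x \<in> J" if "a \<in> J" for a x
      using J that by (auto simp: ring_of_type_algebra_def mult.commute)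
  qed
qed

lemma ideal_sum:
  fixes J :: "'a :: comm_ring_1 set"
  assumes "ideal J ring_of_type_algebra" "\<And>x. x \<in> A \<Longrightarrow> f x \<in> J"
  shows "sum f A \<in> J"
  using assms(2)
  by (induction A rule: infinite_finite_induct)
     (use assms(1) in \<open>auto simp: ideal_ring_of_type_algebra_iff\<close>)

lemma ideal_diff:
  fixes J :: "'a :: comm_ring_1 set"
  assumes "ideal J ring_of_type_algebra" "x \<in> J" "y \<in> J"
  shows "x - y \<in> J"
  using assms unfolding ideal_ring_of_type_algebra_iff
  by (metis mult_minus1 uminus_add_conv_diff add.commute)

lemma prime_ideal_mult_power:
  fixes J :: "'a :: comm_ring_1 set"
  assumes "primeideal J ring_of_type_algebra" "f \<notin> J" "f ^ n * x \<in> J"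
  shows "x \<in> J"
proof -
  interpret primeideal J "ring_of_type_algebra :: 'a ring" by fact
  have prime: "a \<in> J \<or> b \<in> J" if "a * b \<in> J" for a b
    using I_prime[of a b] that by (simp add: ring_of_type_algebra_def)
  show ?thesis
    using assms(3) by (induction n) (use assms(2) prime in \<open>auto simp: mult.assoc\<close>)
qed

section \<open>Polynomials as linear combinations of monomials\<close>

lemma poly_mapping_sum_single:
  "p = (\<Sum>m\<in>Poly_Mapping.keys p. Poly_Mapping.single m (Poly_Mapping.lookup p m))"
  by (rule poly_mapping_eqI)
     (simp add: lookup_sum lookup_single when_def sum.delta' in_keys_iff sum.delta)

lemma lookup_times_single:
  fixes r :: "'a :: comm_monoid_add \<Rightarrow>\<^sub>0 'k :: comm_ring_1"
  shows "Poly_Mapping.lookup (r * Poly_Mapping.single m 1) e =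
    (\<Sum>n\<in>Poly_Mapping.keys r. if n + m = e then Poly_Mapping.lookup r n else 0)"
proof -
  have "r * Poly_Mapping.single m 1 =
      (\<Sum>n\<in>Poly_Mapping.keys r. Poly_Mapping.single (n + m) (Poly_Mapping.lookup r n))"
    by (subst poly_mapping_sum_single[of r]) (simp add: sum_distrib_right mult_single)
  then show ?thesis
    by (simp add: lookup_sum lookup_single when_def)
qed

lemma lookup_times_single_eq:
  fixes r :: "('s \<Rightarrow>\<^sub>0 nat) \<Rightarrow>\<^sub>0 'k :: comm_ring_1"
  shows "Poly_Mapping.lookup (r * Poly_Mapping.single e 1) e = Poly_Mapping.lookup r 0"
  by (simp add: lookup_times_single sum.delta in_keys_iff)

text \<open>Every monomial of a multiple of \<open>m\<close> has at least the exponent of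
  \<open>m\<close> at \<open>k\<close>, so \<open>e\<close> cannot occur.\<close>

lemma lookup_times_single_eq_0:
  fixes r :: "('s \<Rightarrow>\<^sub>0 nat) \<Rightarrow>\<^sub>0 'k :: comm_ring_1"
  assumes "Poly_Mapping.lookup m k > Poly_Mapping.lookup e k"
  shows "Poly_Mapping.lookup (r * Poly_Mapping.single m 1) e = 0"
  unfolding lookup_times_single
  by (rule sum.neutral) (use assms in \<open>auto simp: lookup_add\<close>)

text \<open>Exponents are natural numbers, so only the two constant terms contribute: this is
  evaluation at the origin.\<close>

lemma lookup_times_0:
  fixes p q :: "('s \<Rightarrow>\<^sub>0 nat) \<Rightarrow>\<^sub>0 'k :: comm_ring_1"
  shows "Poly_Mapping.lookup (p * q) 0 = Poly_Mapping.lookup p 0 * Poly_Mapping.lookup q 0"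
proof -
  have zero_iff: "m + n = 0 \<longleftrightarrow> m = 0 \<and> n = 0" for m n :: "'s \<Rightarrow>\<^sub>0 nat"
    by (auto simp: poly_mapping_eq_iff fun_eq_iff lookup_add)
  have "p * q = (\<Sum>m\<in>Poly_Mapping.keys p. \<Sum>n\<in>Poly_Mapping.keys q.
      Poly_Mapping.single (m + n) (Poly_Mapping.lookup p m * Poly_Mapping.lookup q n))"
    by (subst poly_mapping_sum_single[of p], subst poly_mapping_sum_single[of q])
       (simp add: sum_product mult_single)
  then have "Poly_Mapping.lookup (p * q) 0 =
      (\<Sum>m\<in>Poly_Mapping.keys p. \<Sum>n\<in>Poly_Mapping.keys q.
        if m = 0 then if n = 0 then Poly_Mapping.lookup p m * Poly_Mapping.lookup q n else 0 else 0)"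
    by (simp add: lookup_sum lookup_single when_def zero_iff if_distrib if_bool_eq_conj cong: if_cong)
       (auto intro!: sum.cong)
  also have "\<dots> = (\<Sum>m\<in>Poly_Mapping.keys p. if m = 0
      then Poly_Mapping.lookup p m * Poly_Mapping.lookup q 0 else 0)"
    by (intro sum.cong refl) (simp add: sum.delta in_keys_iff)
  also have "\<dots> = Poly_Mapping.lookup p 0 * Poly_Mapping.lookup q 0"
    by (simp add: sum.delta in_keys_iff)
  finally show ?thesis .
qed

text \<open>The ideal of the origin, later put on top of the chains of primes.\<close>

lemma ideal_zero_constant_term:
  "ideal {p :: ('s, 'k :: field) mpoly. Poly_Mapping.lookup p 0 = 0} mpoly_ring"
  by (simp add: ideal_ring_of_type_algebra_iff lookup_add lookup_times_0)

text \<open>Scalars act as constant polynomials, which makes spans and independence over the field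
  available.\<close>

interpretation poly_mapping: vector_space
  "\<lambda>(c :: 'k :: field) (p :: 'm :: comm_monoid_add \<Rightarrow>\<^sub>0 'k). Poly_Mapping.single 0 c * p"
  by unfold_locales
     (simp_all add: algebra_simps single_add mult_single mult.assoc[symmetric])

text \<open>Exchange bound for an indexed family. Two indices with equal vectors would give a
  relation with coefficients 1 and -1, so the family is injective.\<close>

lemma (in vector_space) card_le_of_scalars_zero:
  assumes "finite A" "finite T" "b ` A \<subseteq> span T"
    and indep: "\<And>c x. (\<Sum>x\<in>A. scale (c x) (b x)) = 0 \<Longrightarrow> x \<in> A \<Longrightarrow> c x = 0"
  shows "card A \<le> card T"
proof -
  have inj: "inj_on b A"
  proof (rule inj_onI, rule ccontr)
    fix x y assume xy: "x \<in> A" "y \<in> A" "b x = b y" "x \<noteq> y"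
    define c :: "_ \<Rightarrow> 'a" where "c = (\<lambda>z. if z = x then 1 else if z = y then -1 else 0)"
    have "(\<Sum>z\<in>A. scale (c z) (b z)) = (\<Sum>z\<in>{x, y}. scale (c z) (b z))"
      using xy assms(1) by (intro sum.mono_neutral_right) (auto simp: c_def)
    also have "\<dots> = 0"
      using xy by (simp add: c_def)
    finally have "c x = 0" using indep xy(1) by blast
    then show False by (simp add: c_def)
  qed
  have "independent (b ` A)"
  proof (rule independent_if_scalars_zero)
    fix c v assume "(\<Sum>v\<in>b ` A. scale (c v) v) = 0" "v \<in> b ` A"
    then show "c v = 0"
      using indep[of "\<lambda>x. c (b x)"] by (auto simp: sum.reindex[OF inj])
  qed (use assms in auto)
  then have "card (b ` A) \<le> card T"
    using independent_span_bound assms by blast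
  then show ?thesis by (simp add: card_image[OF inj])
qed

section \<open>Chains of primes\<close>

text \<open>Bounds each exponent separately instead of the total degree, so that the admissible
  monomials are easily counted: there are \<open>(d + 1) ^ CARD('s)\<close>.\<close>

definition degree_box :: "nat \<Rightarrow> ('s, 'k :: field) mpoly set" where
  "degree_box d = {p. \<forall>m\<in>Poly_Mapping.keys p. \<forall>i. Poly_Mapping.lookup m i \<le> d}"

lemma degree_box_mono: "d \<le> e \<Longrightarrow> degree_box d \<subseteq> degree_box e"
  unfolding degree_box_def using le_trans by blast

lemma one_in_degree_box: "1 \<in> degree_box d"
  by (auto simp: degree_box_def in_keys_iff lookup_one when_def split: if_splits)

lemma times_in_degree_box:
  assumes "p \<in> degree_box d" "q \<in> degree_box e"
  shows "p * q \<in> degree_box (d + e)"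
  using assms keys_mult[of p q] unfolding degree_box_def
  by (fastforce simp: lookup_add intro!: add_mono)

lemma power_in_degree_box:
  assumes "p \<in> degree_box d"
  shows "p ^ n \<in> degree_box (n * d)"
  by (induction n) (use assms in \<open>auto intro: one_in_degree_box times_in_degree_box\<close>)

lemma finite_subset_degree_box:
  fixes F :: "('s :: finite, 'k :: field) mpoly set"
  assumes "finite F"
  shows "\<exists>d. F \<subseteq> degree_box d"
proof -
  define E where "E = (\<Union>p\<in>F. \<Union>m\<in>Poly_Mapping.keys p. range (Poly_Mapping.lookup m))"
  have "finite E" using assms by (auto simp: E_def)
  then have "\<forall>e\<in>E. e \<le> Max E" by simp
  then have "F \<subseteq> degree_box (Max E)" by (auto simp: degree_box_def E_def)
  then show ?thesis ..
qed

definition power_product :: "'a :: comm_ring_1 list \<Rightarrow> nat list \<Rightarrow> 'a" where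
  "power_product fs l = prod_list (map2 (\<lambda>f j. f ^ j) fs l)"

lemma power_product_Nil [simp]: "power_product [] l = 1"
  by (simp add: power_product_def)

lemma power_product_Cons [simp]: "power_product (f # fs) (j # l) = f ^ j * power_product fs l"
  by (simp add: power_product_def)

text \<open>Index set for relations of degree at most \<open>N\<close> in each element, in the shape
  of \<open>card_lists_length_eq\<close>.\<close>

abbreviation bounded_lists :: "nat \<Rightarrow> nat \<Rightarrow> nat list set" where
  "bounded_lists N n \<equiv> {l. set l \<subseteq> {..N} \<and> length l = n}"

lemma power_product_in_degree_box:
  assumes "set fs \<subseteq> degree_box d" "l \<in> bounded_lists N (length fs)"
  shows "power_product fs l \<in> degree_box (length fs * N * d)"
  using assms
proof (induction fs arbitrary: l)
  case Nil
  then show ?case by (simp add: one_in_degree_box)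
next
  case (Cons f fs)
  then obtain j l' where l: "l = j # l'" by (cases l) auto
  with Cons.prems have "j * d \<le> N * d" by simp
  then have "f ^ j \<in> degree_box (N * d)"
    using power_in_degree_box[of f d j] degree_box_mono[of "j * d" "N * d"] Cons.prems by auto
  moreover have "power_product fs l' \<in> degree_box (length fs * N * d)"
    using Cons l by auto
  ultimately show ?case
    using times_in_degree_box by (fastforce simp: l algebra_simps)
qed

lemma degree_box_finite_span:
  obtains T :: "('s :: finite, 'k :: field) mpoly set"
  where "finite T" "card T \<le> (d + 1) ^ CARD('s)" "degree_box d \<subseteq> poly_mapping.span T"
proof
  define M :: "('s \<Rightarrow>\<^sub>0 nat) set" where "M = exponent_vector ` (UNIV \<rightarrow>\<^sub>E {..d})"
  define T :: "('s, 'k) mpoly set" where "T = (\<lambda>m. Poly_Mapping.single m 1) ` M"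
  have fin: "finite (UNIV \<rightarrow>\<^sub>E {..d} :: ('s \<Rightarrow> nat) set)"
    by (intro finite_PiE) auto
  then show "finite T" by (simp add: T_def M_def)
  have "card T \<le> card (UNIV \<rightarrow>\<^sub>E {..d} :: ('s \<Rightarrow> nat) set)"
    unfolding T_def M_def image_image using fin by (rule card_image_le)
  then show "card T \<le> (d + 1) ^ CARD('s)" by (simp add: card_PiE)
  show "degree_box d \<subseteq> poly_mapping.span T"
  proof
    fix p :: "('s, 'k) mpoly" assume p: "p \<in> degree_box d"
    have "(\<Sum>m\<in>Poly_Mapping.keys p. Poly_Mapping.single m (Poly_Mapping.lookup p m))
        \<in> poly_mapping.span T"
    proof (rule poly_mapping.span_sum)
      fix m assume m: "m \<in> Poly_Mapping.keys p"
      have "m = exponent_vector (Poly_Mapping.lookup m)"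
        by (rule poly_mapping_eqI) (simp add: exponent_vector.rep_eq)
      moreover have "Poly_Mapping.lookup m \<in> UNIV \<rightarrow>\<^sub>E {..d}"
        using p m by (auto simp: degree_box_def)
      ultimately have "m \<in> M" unfolding M_def by blast
      then have "Poly_Mapping.single 0 (Poly_Mapping.lookup p m) * Poly_Mapping.single m 1
          \<in> poly_mapping.span T"
        by (intro poly_mapping.span_scale poly_mapping.span_base) (auto simp: T_def)
      then show "Poly_Mapping.single m (Poly_Mapping.lookup p m) \<in> poly_mapping.span T"
        by (simp add: mult_single)
    qed
    then show "p \<in> poly_mapping.span T" by (simp flip: poly_mapping_sum_single)
  qed
qed

text \<open>The elements \<open>fs\<close> are picked one from each step of the chain. The relation is divided by the
  lowest power of the first one, and its constant term is then a relation one step up.\<close>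

lemma prime_chain_algebraically_independent:
  fixes C :: "nat \<Rightarrow> ('s, 'k :: field) mpoly set"
  assumes "\<And>i. i < length fs \<Longrightarrow> primeideal (C i) mpoly_ring"
    and "\<And>i. i < length fs \<Longrightarrow> C i \<subseteq> C (Suc i)"
    and "\<And>i. i < length fs \<Longrightarrow> fs ! i \<in> C (Suc i) - C i"
    and "ideal (C (length fs)) mpoly_ring" "1 \<notin> C (length fs)"
    and "(\<Sum>l\<in>bounded_lists N (length fs). Poly_Mapping.single 0 (c l) * power_product fs l) \<in> C 0"
    and "l \<in> bounded_lists N (length fs)"
  shows "c l = 0"
  using assms
proof (induction fs arbitrary: C c l)
  case Nil
  have "bounded_lists N 0 = {[]}" by auto
  with Nil have "Poly_Mapping.single 0 (c []) \<in> C 0" "l = []" by auto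
  \<comment> \<open>A nonzero constant would put 1 into the proper ideal \<open>C 0\<close>.\<close>
  then have "Poly_Mapping.single 0 (inverse (c [])) * Poly_Mapping.single 0 (c []) \<in> C 0"
    using Nil.prems(4) by (auto simp: ideal_ring_of_type_algebra_iff)
  with Nil.prems(5) show ?case
    using \<open>l = []\<close> by (cases "c [] = 0") (auto simp: mult_single)
next
  case (Cons f fs)
  define B where "B = bounded_lists N (length fs)"
  \<comment> \<open>The relation is read as a polynomial in the first element \<open>f\<close>, with
    coefficients \<open>h j\<close> in the remaining ones.\<close>
  define h where "h j = (\<Sum>l\<in>B. Poly_Mapping.single 0 (c (j # l)) * power_product fs l)" for j
  have prime: "primeideal (C 0) mpoly_ring" and sub: "C 0 \<subseteq> C 1" and f: "f \<in> C 1" "f \<notin> C 0"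
    using Cons.prems(1-3)[of 0] by auto
  \<comment> \<open>If \<open>fs\<close> is empty, \<open>C 1\<close> is the top of the chain, which
    is only a proper ideal and not known to be prime.\<close>
  have C1: "ideal (C 1) mpoly_ring"
    using Cons.prems(1)[of 1] Cons.prems(4) by (cases fs) (auto intro: primeideal.axioms(1))
  \<comment> \<open>The induction hypothesis for the chain starting at \<open>C 1\<close>. It
    applies because relations are only taken modulo the bottom of the chain.\<close>
  have h_C1: "c (j # l) = 0" if "h j \<in> C 1" "l \<in> B" for j l
  proof (rule Cons.IH[of "\<lambda>i. C (Suc i)" "\<lambda>l. c (j # l)" l])
    show "primeideal (C (Suc i)) mpoly_ring" "C (Suc i) \<subseteq> C (Suc (Suc i))"
      "fs ! i \<in> C (Suc (Suc i)) - C (Suc i)" if "i < length fs" for i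
      using Cons.prems(1-3)[of "Suc i"] that by simp_all
    show "ideal (C (Suc (length fs))) mpoly_ring" "1 \<notin> C (Suc (length fs))"
      using Cons.prems(4,5) by simp_all
    show "(\<Sum>l\<in>bounded_lists N (length fs).
        Poly_Mapping.single 0 (c (j # l)) * power_product fs l) \<in> C (Suc 0)"
      using that(1) by (simp add: h_def B_def)
    show "l \<in> bounded_lists N (length fs)"
      using that(2) by (simp add: B_def)
  qed
  have lists: "bounded_lists N (Suc (length fs)) = (\<lambda>(j, l). j # l) ` ({..N} \<times> B)"
    by (auto simp: B_def length_Suc_conv)
  have inj: "inj_on (\<lambda>(j, l). j # l) ({..N} \<times> B)" by (auto simp: inj_on_def)
  have total: "(\<Sum>j\<le>N. f ^ j * h j) \<in> C 0"
  proof -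
    have "(\<Sum>j\<le>N. f ^ j * h j) = (\<Sum>(j, l)\<in>{..N} \<times> B.
        Poly_Mapping.single 0 (c (j # l)) * power_product (f # fs) (j # l))"
      by (simp add: h_def sum_distrib_left algebra_simps sum.cartesian_product)
    also have "\<dots> = (\<Sum>l\<in>bounded_lists N (Suc (length fs)).
        Poly_Mapping.single 0 (c l) * power_product (f # fs) l)"
      unfolding lists by (subst sum.reindex[OF inj]) (simp add: case_prod_unfold)
    also have "\<dots> \<in> C 0" using Cons.prems(6) by simp
    finally show ?thesis .
  qed
  \<comment> \<open>Once the lower coefficients vanish, \<open>f ^ j\<close> factors out and can be
    cancelled, as \<open>C 0\<close> is prime and does not contain \<open>f\<close>.\<close>
  have zero: "\<forall>l\<in>B. c (j # l) = 0" if "j \<le> N" for j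
    using that
  proof (induction j rule: less_induct)
    case (less j)
    have h0: "h i = 0" if "i < j" for i
      unfolding h_def using less that by (intro sum.neutral) auto
    have split: "{..N} = {..<j} \<union> {j..N}" "{..<j} \<inter> {j..N} = {}"
      using less.prems by auto
    have "(\<Sum>i\<le>N. f ^ i * h i) = (\<Sum>i\<in>{j..N}. f ^ i * h i)"
      unfolding split(1) by (subst sum.union_disjoint) (auto simp: h0)
    also have "\<dots> = f ^ j * (\<Sum>i\<in>{j..N}. f ^ (i - j) * h i)"
      unfolding sum_distrib_left
      by (intro sum.cong refl) (simp add: mult.assoc[symmetric] power_add[symmetric])
    finally have "f ^ j * (\<Sum>i\<in>{j..N}. f ^ (i - j) * h i) \<in> C 0"
      using total by simp
    then have "(\<Sum>i\<in>{j..N}. f ^ (i - j) * h i) \<in> C 0"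
      by (rule prime_ideal_mult_power[OF prime f(2)])
    then have 1: "(\<Sum>i\<in>{j..N}. f ^ (i - j) * h i) \<in> C 1" using sub by auto
    \<comment> \<open>The later terms keep a factor \<open>f\<close>, which lies in
      \<open>C 1\<close>; hence \<open>h j\<close> lies in \<open>C 1\<close> too.\<close>
    have 2: "(\<Sum>i\<in>{j<..N}. f ^ (i - j) * h i) \<in> C 1"
    proof (rule ideal_sum[OF C1])
      fix i assume "i \<in> {j<..N}"
      then obtain k where "i - j = Suc k"
        by (metis Suc_diff_Suc greaterThanAtMost_iff)
      then have "f ^ (i - j) * h i = (f ^ k * h i) * f"
        by (simp add: mult_ac)
      then show "f ^ (i - j) * h i \<in> C 1"
        using C1 f(1) by (auto simp: ideal_ring_of_type_algebra_iff)
    qed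
    have "(\<Sum>i\<in>{j..N}. f ^ (i - j) * h i) = h j + (\<Sum>i\<in>{j<..N}. f ^ (i - j) * h i)"
      using less.prems by (subst sum.head) auto
    then have "h j \<in> C 1"
      using ideal_diff[OF C1 1 2] by simp
    then show ?case using h_C1 by blast
  qed
  show ?case using Cons.prems(7) zero by (auto simp: lists)
qed

text \<open>With \<open>n\<close> elements, the \<open>(N + 1) ^ n\<close> power products are
  independent but lie in a space whose dimension grows only like \<open>N ^ CARD('s)\<close>. For
  large \<open>N\<close> this excludes \<open>n > CARD('s)\<close>.\<close>

lemma algebraically_independent_length_le:
  fixes fs :: "('s :: finite, 'k :: field) mpoly list"
  assumes "\<And>N c l. (\<Sum>l\<in>bounded_lists N (length fs).
      Poly_Mapping.single 0 (c l) * power_product fs l) = 0 \<Longrightarrow>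
    l \<in> bounded_lists N (length fs) \<Longrightarrow> c l = 0"
  shows "length fs \<le> CARD('s)"
proof (rule ccontr)
  assume long: "\<not> length fs \<le> CARD('s)"
  obtain d where d: "set fs \<subseteq> degree_box d"
    using finite_subset_degree_box[of "set fs"] by auto
  \<comment> \<open>\<open>D\<close> gives \<open>length fs * N * d + 1 \<le> D * (N + 1)\<close>.
    The choice of \<open>N\<close> turns \<open>(D * (N + 1)) ^ CARD('s)\<close> into
    \<open>N * (N + 1) ^ CARD('s)\<close>, just below the number of power products.\<close>
  define D where "D = length fs * d + 1"
  define N where "N = D ^ CARD('s)"
  obtain T :: "('s, 'k) mpoly set" where T: "finite T"
      "card T \<le> (length fs * N * d + 1) ^ CARD('s)"
      "degree_box (length fs * N * d) \<subseteq> poly_mapping.span T"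
    using degree_box_finite_span by blast
  have "(N + 1) ^ Suc (CARD('s)) \<le> (N + 1) ^ length fs"
    using long by (intro power_increasing) auto
  also have "\<dots> = card (bounded_lists N (length fs))"
    by (simp add: card_lists_length_eq)
  also have "\<dots> \<le> card T"
  proof (rule poly_mapping.card_le_of_scalars_zero[of _ _ "power_product fs"])
    show "finite (bounded_lists N (length fs))" by (rule finite_lists_length_eq) simp
    show "power_product fs ` bounded_lists N (length fs) \<subseteq> poly_mapping.span T"
      using power_product_in_degree_box[OF d] T(3) by blast
  qed (use assms T in auto)
  also have "\<dots> \<le> (D * (N + 1)) ^ CARD('s)"
    using T(2) by (rule order.trans) (auto intro!: power_mono simp: D_def algebra_simps)
  also have "\<dots> = N * (N + 1) ^ CARD('s)"
    by (simp only: power_mult_distrib N_def)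
  finally show False by simp
qed

text \<open>Putting \<open>J\<close> on top of a chain of length \<open>n\<close> ending in
  \<open>P\<close> gives \<open>n + 1\<close> steps. One element from each step yields
  \<open>n + 1\<close> algebraically independent polynomials.\<close>

lemma prime_height_less_card:
  fixes P :: "('s :: finite, 'k :: field) mpoly set"
  assumes "P \<subset> J" "ideal J mpoly_ring" "1 \<notin> J"
  shows "prime_height mpoly_ring P \<le> enat (CARD('s) - 1)"
  unfolding prime_height_def
proof (rule Sup_least, safe)
  fix n and C :: "nat \<Rightarrow> ('s, 'k) mpoly set"
  assume C: "\<forall>i\<le>n. primeideal (C i) mpoly_ring" "\<forall>i<n. C i \<subset> C (Suc i)" "P = C n"
  define C' where "C' = C(Suc n := J)"
  have C'_prime: "primeideal (C' i) mpoly_ring" if "i < Suc n" for i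
    using C(1) that by (auto simp: C'_def)
  have C'_sub: "C' i \<subset> C' (Suc i)" if "i < Suc n" for i
    using C(2,3) assms(1) that by (auto simp: C'_def less_Suc_eq)
  then have "\<forall>i. \<exists>f. i < Suc n \<longrightarrow> f \<in> C' (Suc i) - C' i" by blast
  then obtain f where f: "\<And>i. i < Suc n \<Longrightarrow> f i \<in> C' (Suc i) - C' i" by metis
  define fs where "fs = map f [0..<Suc n]"
  have len: "length fs = Suc n" by (simp add: fs_def)
  have nth: "fs ! i = f i" if "i < Suc n" for i
    using that unfolding fs_def by (subst nth_map) (auto simp del: upt_Suc)
  have zero: "0 \<in> C' 0"
    using C'_prime[of 0]
    by (auto dest!: primeideal.axioms(1) simp: ideal_ring_of_type_algebra_iff)
  have "length fs \<le> CARD('s)"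
  proof (rule algebraically_independent_length_le)
    fix N c l
    assume "(\<Sum>l\<in>bounded_lists N (length fs).
        Poly_Mapping.single 0 (c l) * power_product fs l) = 0"
      "l \<in> bounded_lists N (length fs)"
    then show "c l = 0"
      using C'_prime C'_sub f nth zero assms(2,3)
      by (intro prime_chain_algebraically_independent[where fs = fs and C = C' and N = N])
         (auto simp: len psubset_imp_subset C'_def)
  qed
  then show "enat n \<le> enat (CARD('s) - 1)" by (simp add: len)
qed

section \<open>The monomial curve\<close>

text \<open>The substitution of \<open>T ^ w i\<close> for the variable \<open>i\<close>, with
  values in the univariate polynomials in \<open>T\<close>.\<close>

definition monomial_curve :: "('s :: finite \<Rightarrow> nat) \<Rightarrow> ('s, 'k :: field) mpoly \<Rightarrow> 'k poly" where
  "monomial_curve w p = (\<Sum>m\<in>Poly_Mapping.keys p.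
     monom (Poly_Mapping.lookup p m) (\<Sum>i\<in>UNIV. w i * Poly_Mapping.lookup m i))"

text \<open>Allows several polynomials to be summed over one common set of exponents.\<close>

lemma monomial_curve_superset:
  assumes "finite A" "Poly_Mapping.keys p \<subseteq> A"
  shows "monomial_curve w p = (\<Sum>m\<in>A.
    monom (Poly_Mapping.lookup p m) (\<Sum>i\<in>UNIV. w i * Poly_Mapping.lookup m i))"
  unfolding monomial_curve_def using assms
  by (intro sum.mono_neutral_left) (auto simp: in_keys_iff)

lemma monomial_curve_add: "monomial_curve w (p + q) = monomial_curve w p + monomial_curve w q"
proof -
  define A where "A = Poly_Mapping.keys p \<union> Poly_Mapping.keys q"
  have "Poly_Mapping.keys (p + q) \<subseteq> A" using keys_add[of p q] by (auto simp: A_def)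
  then show ?thesis
    using monomial_curve_superset[of A "p + q" w] monomial_curve_superset[of A p w]
      monomial_curve_superset[of A q w]
    by (simp add: A_def lookup_add add_monom[symmetric] sum.distrib)
qed

lemma monomial_curve_0 [simp]: "monomial_curve w 0 = 0"
  by (simp add: monomial_curve_def)

lemma monomial_curve_sum: "monomial_curve w (sum f A) = (\<Sum>x\<in>A. monomial_curve w (f x))"
  by (induction A rule: infinite_finite_induct) (auto simp: monomial_curve_add)

lemma monomial_curve_single:
  "monomial_curve w (Poly_Mapping.single m c) = monom c (\<Sum>i\<in>UNIV. w i * Poly_Mapping.lookup m i)"
  by (cases "c = 0") (auto simp: monomial_curve_def)

lemma monomial_curve_mult: "monomial_curve w (p * q) = monomial_curve w p * monomial_curve w q"
proof -
  have "p * q = (\<Sum>m\<in>Poly_Mapping.keys p. \<Sum>n\<in>Poly_Mapping.keys q.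
      Poly_Mapping.single (m + n) (Poly_Mapping.lookup p m * Poly_Mapping.lookup q n))"
    by (subst poly_mapping_sum_single[of p], subst poly_mapping_sum_single[of q])
       (simp add: sum_product mult_single)
  then have "monomial_curve w (p * q) = (\<Sum>m\<in>Poly_Mapping.keys p. \<Sum>n\<in>Poly_Mapping.keys q.
      monom (Poly_Mapping.lookup p m) (\<Sum>i\<in>UNIV. w i * Poly_Mapping.lookup m i) *
      monom (Poly_Mapping.lookup q n) (\<Sum>i\<in>UNIV. w i * Poly_Mapping.lookup n i))"
    by (simp add: monomial_curve_sum monomial_curve_single lookup_add distrib_left sum.distrib
        mult_monom)
  then show ?thesis
    by (simp only: monomial_curve_def sum_product)
qed

text \<open>The substitution is a ring homomorphism into an integral domain that maps 1 to 1, so its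
  kernel is prime.\<close>

lemma primeideal_monomial_curve_kernel:
  "primeideal {p :: ('s :: finite, 'k :: field) mpoly. monomial_curve w p = 0} mpoly_ring"
proof (rule primeidealI)
  show "ideal {p :: ('s, 'k) mpoly. monomial_curve w p = 0} mpoly_ring"
    by (simp add: ideal_ring_of_type_algebra_iff monomial_curve_add monomial_curve_mult)
  show "cring (mpoly_ring :: ('s, 'k) mpoly ring)" by (rule cring_from_type_algebra)
  have "monomial_curve w (1 :: ('s, 'k) mpoly) = 1"
    using monomial_curve_single[of w 0 "1 :: 'k"] by (simp add: one_pCons monom_0)
  then have "(1 :: ('s, 'k) mpoly) \<notin> {p. monomial_curve w p = 0}" by simp
  then show "carrier mpoly_ring \<noteq> {p :: ('s, 'k) mpoly. monomial_curve w p = 0}"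
    by (auto simp: ring_of_type_algebra_def)
qed (auto simp: ring_of_type_algebra_def monomial_curve_mult)

section \<open>The binomials of a generalized critical binomial matrix\<close>

text \<open>Orthogonality of \<open>a\<close> and \<open>b\<close> says that both monomials have the
  same weight, so they are mapped to the same power of \<open>T\<close>.\<close>

lemma monomial_curve_binomial_of:
  fixes a b :: "int ^ 's :: finite"
  assumes "\<And>i. b $ i > 0" "(\<Sum>i\<in>UNIV. a $ i * b $ i) = 0"
  shows "monomial_curve (\<lambda>i. nat (b $ i)) (binomial_of a :: ('s, 'k :: field) mpoly) = 0"
proof -
  define M :: "('s \<Rightarrow> nat) \<Rightarrow> nat" where "M c = (\<Sum>i\<in>UNIV. nat (b $ i) * c i)" for c
  have curve: "monomial_curve (\<lambda>i. nat (b $ i)) (monomial c :: ('s, 'k) mpoly) = monom 1 (M c)" for c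
    by (simp add: monomial_def monomial_curve_single exponent_vector.rep_eq M_def)
  \<comment> \<open>Passing to integers avoids truncated subtraction; each entry is its positive
    minus its negative part.\<close>
  have "int (M (\<lambda>i. nat (a $ i))) - int (M (\<lambda>i. nat (- (a $ i)))) = (\<Sum>i\<in>UNIV. a $ i * b $ i)"
    unfolding M_def of_nat_sum sum_subtractf[symmetric]
    by (intro sum.cong refl) (use assms(1) in \<open>simp add: less_imp_le\<close>)
  then have eq: "M (\<lambda>i. nat (a $ i)) = M (\<lambda>i. nat (- (a $ i)))"
    using assms(2) by simp
  have "monomial_curve (\<lambda>i. nat (b $ i)) (binomial_of a :: ('s, 'k) mpoly) +
      monomial_curve (\<lambda>i. nat (b $ i)) (monomial (\<lambda>i. nat (- (a $ i))) :: ('s, 'k) mpoly) =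
      monomial_curve (\<lambda>i. nat (b $ i)) (monomial (\<lambda>i. nat (a $ i)) :: ('s, 'k) mpoly)"
    by (simp flip: monomial_curve_add add: binomial_of_def)
  then show ?thesis by (simp add: curve eq)
qed

text \<open>The rows are orthogonal to \<open>b\<close>, so \<open>I\<close> lies in the prime
  kernel \<open>P\<close>. As \<open>P\<close> is strictly below the ideal \<open>J\<close> of the
  origin, its height is less than \<open>CARD('s)\<close>.\<close>

lemma ideal_height_GCB_less_card:
  fixes L :: "int ^ 's ^ ('s :: finite)"
    and I :: "('s, 'k :: field) mpoly set"
  assumes "GCB_matrix L" "I = Idl\<^bsub>mpoly_ring\<^esub> (range (\<lambda>i. binomial_of (L $ i)))"
  shows "ideal_height mpoly_ring I < enat (CARD('s))"
proof -
  obtain b :: "int ^ 's" where b: "\<And>i. b $ i > 0" "L *v b = 0"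
    using assms(1) by (auto simp: GCB_matrix_def)
  have Lb: "(\<Sum>j\<in>UNIV. L $ i $ j * b $ j) = 0" for i
    using b(2) by (simp add: matrix_vector_mult_def vec_eq_iff)
  define w where "w = (\<lambda>i. nat (b $ i))"
  define P where "P = {p :: ('s, 'k) mpoly. monomial_curve w p = 0}"
  define J where "J = {p :: ('s, 'k) mpoly. Poly_Mapping.lookup p 0 = 0}"
  have prime: "primeideal P mpoly_ring"
    unfolding P_def by (rule primeideal_monomial_curve_kernel)
  interpret R: ring "mpoly_ring :: ('s, 'k) mpoly ring" by (rule ring_from_type_algebra)
  have "I \<subseteq> P"
    unfolding assms(2) using monomial_curve_binomial_of[OF b(1) Lb]
    by (intro R.genideal_minimal primeideal.axioms(1)[OF prime]) (auto simp: P_def w_def)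
  have "P \<subset> J"
  proof
    show "P \<subseteq> J"
    proof
      fix p assume p: "p \<in> P"
      \<comment> \<open>All weights are positive, so only the constant monomial is mapped to a
        constant.\<close>
      have weight: "(\<Sum>i\<in>UNIV. w i * Poly_Mapping.lookup m i) = 0 \<longleftrightarrow> m = 0" for m
        using b(1) by (simp add: w_def poly_mapping_eq_iff fun_eq_iff not_le[symmetric])
      have "coeff (monomial_curve w p) 0 = Poly_Mapping.lookup p 0"
        by (simp add: monomial_curve_def coeff_sum weight sum.delta in_keys_iff)
      with p show "p \<in> J" by (simp add: P_def J_def)
    qed
    \<comment> \<open>\<open>undefined\<close> stands for an arbitrary variable. It vanishes at the
      origin but is mapped to a power of \<open>T\<close>, hence not to zero.\<close>
    define x :: "('s, 'k) mpoly" where "x = Poly_Mapping.single (Poly_Mapping.single undefined 1) 1"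
    have "x \<in> J"
      by (auto simp: x_def J_def lookup_single when_def poly_mapping_eq_iff fun_eq_iff)
    moreover have "x \<notin> P"
      by (simp add: x_def P_def monomial_curve_single)
    ultimately show "P \<noteq> J" by blast
  qed
  then have "prime_height mpoly_ring P \<le> enat (CARD('s) - 1)"
    using prime_height_less_card[of P J] ideal_zero_constant_term by (auto simp: J_def lookup_one)
  moreover have "ideal_height mpoly_ring I \<le> prime_height mpoly_ring P"
    unfolding ideal_height_def using prime \<open>I \<subseteq> P\<close> by (intro Inf_lower) auto
  ultimately have "ideal_height mpoly_ring I \<le> enat (CARD('s) - 1)" by order
  also have "\<dots> < enat (CARD('s))" by simp
  finally show ?thesis .
qed

text \<open>A column vector of coefficients that is semilinear along \<open>r \<mapsto> r(0)\<close> on an ideal factors through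
  \<open>I / (t 1, \<dots>, t s) I\<close>.\<close>

lemma card_generators_ge:
  fixes F :: "('s, 'k :: field) mpoly set" and v :: "'j :: finite \<Rightarrow> 's \<Rightarrow>\<^sub>0 nat"
  assumes "finite F" "Idl\<^bsub>mpoly_ring\<^esub> F = Idl\<^bsub>mpoly_ring\<^esub> (range g)"
    and semilinear: "\<And>i j r. Poly_Mapping.lookup (r * g j) (v i) =
      (if i = j then Poly_Mapping.lookup r 0 else 0)"
  shows "CARD('j) \<le> card F"
proof -
  define \<Lambda> :: "('s, 'k) mpoly \<Rightarrow> 'k ^ 'j" where "\<Lambda> p = (\<chi> i. Poly_Mapping.lookup p (v i))" for p
  \<comment> \<open>The coefficient map need not be semilinear on the whole ring. The polynomials at
    which it is form an ideal, which contains every \<open>g j\<close> and hence all of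
    \<open>F\<close>.\<close>
  define T where "T = {p. \<forall>r. \<Lambda> (r * p) = Poly_Mapping.lookup r 0 *s \<Lambda> p}"
  interpret R: ring "mpoly_ring :: ('s, 'k) mpoly ring" by (rule ring_from_type_algebra)
  have \<Lambda>_add: "\<Lambda> (p + q) = \<Lambda> p + \<Lambda> q" for p q
    by (simp add: \<Lambda>_def vec_eq_iff lookup_add)
  have \<Lambda>_0: "\<Lambda> 0 = 0"
    by (simp add: \<Lambda>_def vec_eq_iff)
  have T_mult: "r * p \<in> T" if "p \<in> T" for r p
    using that by (simp add: T_def lookup_times_0 mult.assoc[symmetric])
  have T: "ideal T mpoly_ring"
    unfolding ideal_ring_of_type_algebra_iff
    using T_mult by (auto simp: T_def \<Lambda>_add \<Lambda>_0 distrib_left vec.scale_right_distrib)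
  have \<Lambda>_g: "\<Lambda> (r * g j) = Poly_Mapping.lookup r 0 *s axis j 1" for r j
    by (auto simp: \<Lambda>_def semilinear axis_def vec_eq_iff)
  have "\<Lambda> (g j) = axis j 1" for j
    using \<Lambda>_g[of 1 j] by (simp add: lookup_one)
  then have "range g \<subseteq> T"
    using \<Lambda>_g by (auto simp: T_def)
  then have "Idl\<^bsub>mpoly_ring\<^esub> F \<subseteq> T"
    unfolding assms(2) by (intro R.genideal_minimal T)
  then have "F \<subseteq> T"
    using R.genideal_self[of F] by (auto simp: ring_of_type_algebra_def)
  \<comment> \<open>Semilinearity makes \<open>U\<close> an ideal. It contains \<open>F\<close>,
    hence every \<open>g j\<close>, so the span contains the standard basis.\<close>
  define U where "U = {p \<in> T. \<Lambda> p \<in> vec.span (\<Lambda> ` F)}"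
  have "ideal U mpoly_ring"
    using T unfolding ideal_ring_of_type_algebra_iff U_def
    by (auto simp: \<Lambda>_add \<Lambda>_0 vec.span_add vec.span_zero)
       (auto simp: T_def vec.span_scale)
  moreover have "F \<subseteq> U"
    using \<open>F \<subseteq> T\<close> by (auto simp: U_def vec.span_base)
  ultimately have "Idl\<^bsub>mpoly_ring\<^esub> (range g) \<subseteq> U"
    unfolding assms(2)[symmetric] by (intro R.genideal_minimal)
  moreover have "range g \<subseteq> Idl\<^bsub>mpoly_ring\<^esub> (range g)"
    by (rule R.genideal_self) (simp add: ring_of_type_algebra_def)
  ultimately have "axis j 1 \<in> vec.span (\<Lambda> ` F)" for j
    using \<open>\<And>j. \<Lambda> (g j) = axis j 1\<close> by (auto simp: U_def subset_iff) (metis rangeI)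
  then have "(cart_basis :: ('k ^ 'j) set) \<subseteq> vec.span (\<Lambda> ` F)"
    by (auto simp: cart_basis_def)
  then have "card (cart_basis :: ('k ^ 'j) set) \<le> card (\<Lambda> ` F)"
    using vec.independent_span_bound[OF _ independent_cart_basis] assms(1) by blast
  also have "\<dots> \<le> card F" using assms(1) by (rule card_image_le)
  finally show ?thesis by (simp add: card_cart_basis)
qed

text \<open>The signs in row \<open>j\<close> make its positive part a pure power of the variable
  \<open>j\<close>; three variables in the support keep the other monomial from dividing any pure
  power.\<close>

lemma GCB_lookup_times_binomial_of:
  fixes L :: "int ^ 's ^ ('s :: finite)" and r :: "('s, 'k :: field) mpoly"
  assumes "GCB_matrix L" "card (supp (binomial_of (L $ j) :: ('s, 'k) mpoly)) \<ge> 3"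
  shows "Poly_Mapping.lookup (r * binomial_of (L $ j)) (Poly_Mapping.single i (nat (L $ i $ i))) =
    (if i = j then Poly_Mapping.lookup r 0 else 0)"
proof -
  define e where "e = Poly_Mapping.single i (nat (L $ i $ i))"
  have diag: "L $ j $ j > 0" and off: "\<And>k. k \<noteq> j \<Longrightarrow> L $ j $ k \<le> 0"
    using assms(1) unfolding GCB_matrix_def by (blast, metis)
  have pos: "exponent_vector (\<lambda>k. nat (L $ j $ k)) = Poly_Mapping.single j (nat (L $ j $ j))"
    by (rule poly_mapping_eqI) (auto simp: exponent_vector.rep_eq lookup_single when_def off)
  define n where "n = exponent_vector (\<lambda>k. nat (- (L $ j $ k)))"
  have binom: "binomial_of (L $ j) =
      Poly_Mapping.single (Poly_Mapping.single j (nat (L $ j $ j))) (1 :: 'k) - Poly_Mapping.single n 1"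
    by (simp add: binomial_of_def monomial_def pos n_def)
  \<comment> \<open>Otherwise the negative part involves at most the variable \<open>i\<close>,
    leaving only \<open>i\<close> and \<open>j\<close> in the support.\<close>
  have "\<exists>k. k \<noteq> i \<and> Poly_Mapping.lookup n k > 0"
  proof (rule ccontr)
    assume "\<not> ?thesis"
    then have "Poly_Mapping.keys n \<subseteq> {i}" by (auto simp: in_keys_iff)
    moreover have "supp (binomial_of (L $ j) :: ('s, 'k) mpoly) \<subseteq> {j} \<union> Poly_Mapping.keys n"
      unfolding supp_def binom
      using keys_diff[of "Poly_Mapping.single (Poly_Mapping.single j (nat (L $ j $ j))) (1 :: 'k)"
          "Poly_Mapping.single n 1"]
      by (auto split: if_splits)
    ultimately have "supp (binomial_of (L $ j) :: ('s, 'k) mpoly) \<subseteq> {j, i}" by blast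
    then have "card (supp (binomial_of (L $ j) :: ('s, 'k) mpoly)) \<le> card {j, i}"
      by (intro card_mono) auto
    also have "\<dots> \<le> 2" by (simp add: card_insert_if)
    finally show False using assms(2) by simp
  qed
  then obtain k where "k \<noteq> i" "Poly_Mapping.lookup n k > 0" by blast
  then have "Poly_Mapping.lookup (r * Poly_Mapping.single n 1) e = 0"
    by (intro lookup_times_single_eq_0[of _ k]) (auto simp: e_def lookup_single)
  \<comment> \<open>For \<open>i \<noteq> j\<close> a positive power of the variable
    \<open>j\<close> does not divide a pure power of the variable \<open>i\<close>.\<close>
  moreover have "Poly_Mapping.lookup
      (r * Poly_Mapping.single (Poly_Mapping.single j (nat (L $ j $ j))) 1) e = 0" if "i \<noteq> j"
    using that diag by (intro lookup_times_single_eq_0[of _ j]) (auto simp: e_def lookup_single)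
  moreover have "Poly_Mapping.lookup (r * Poly_Mapping.single e 1) e = Poly_Mapping.lookup r 0"
    by (rule lookup_times_single_eq)
  ultimately show ?thesis
    by (auto simp: binom e_def right_diff_distrib lookup_minus)
qed

theorem proposition6p2:
  fixes L :: "int ^ 's ^ ('s :: finite)"
    and g :: "'s \<Rightarrow> ('s, 'k :: field) mpoly"
    and I :: "('s, 'k) mpoly set"
  assumes "GCB_matrix L"
    and "\<And>i. g i = binomial_of (L $ i)"
    and "I = Idl\<^bsub>mpoly_ring\<^esub> (range g)"
    and "\<And>i. zero_locus (Idl\<^bsub>mpoly_ring\<^esub> (insert (var i) I)) = {0}"
    and "\<And>i. card (supp (g i)) \<ge> 3"
  shows "\<not> complete_intersection mpoly_ring I"
proof
  assume "complete_intersection mpoly_ring I"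
  then obtain fs where fs: "enat (length fs) = ideal_height mpoly_ring I"
      "I = Idl\<^bsub>mpoly_ring\<^esub> (set fs)"
    by (auto simp: complete_intersection_def)
  have g: "g = (\<lambda>i. binomial_of (L $ i))" using assms(2) by auto
  have "CARD('s) \<le> card (set fs)"
  proof (rule card_generators_ge)
    show "Idl\<^bsub>mpoly_ring\<^esub> (set fs) = Idl\<^bsub>mpoly_ring\<^esub> (range g)"
      using fs(2) assms(3) by simp
    show "Poly_Mapping.lookup (r * g j) (Poly_Mapping.single i (nat (L $ i $ i))) =
        (if i = j then Poly_Mapping.lookup r 0 else 0)" for i j r
      unfolding g by (rule GCB_lookup_times_binomial_of[OF assms(1) assms(5)[of j, unfolded g]])
  qed simp
  \<comment> \<open>The list may repeat generators, which only makes it longer.\<close>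
  also have "\<dots> \<le> length fs" by (rule card_length)
  finally have "CARD('s) \<le> length fs" .
  moreover have "enat (length fs) < enat (CARD('s))"
    using ideal_height_GCB_less_card[OF assms(1)] assms(3) fs(1) by (simp add: g)
  ultimately show False by simp
qed

end
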